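(* Let $T:=\bigcup_{b\geq 2} T_b$, where $T_b$ is the set of Trott numbers in base $b$. Then $T$ is nowhere dense and $\dim_H T<1$, where $\dim_H$ denotes Hausdorff dimension.
   Context: Let $b\geq 2$ be an integer. A real number $x$ is a Trott number in base $b$ if $x\in(0,1)$ has an infinite continued fraction expansion $x=[0;a_1,a_2,a_3,\dots]$ with all $a_i$ positive integers, and the base-$b$ expansion of $x$ is $x=(0.\hat{a}_1\hat{a}_2\hat{a}_3\dots)_b$, where $\hat{a}_i$ denotes the string of base-$b$ digits of $a_i$ (without leading zeros) and the strings are concatenated. $T_b$ denotes the set of Trott numbers in base $b$. *)

theory Defs
  imports "HOL-Analysis.Analysis" "HOL-Library.Stream"
begin

text \<open>Base-\<open>b\<close> digits, most significant first and without leading zeros.  The guard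
  \<open>b < 2\<close> only serves termination.\<close>

fun base_digits :: "nat \<Rightarrow> nat \<Rightarrow> nat list" where
  "base_digits b n = (if b < 2 \<or> n < b then [n] else base_digits b (n div b) @ [n mod b])"

declare base_digits.simps [simp del]

text \<open>\<open>cfrac_list [a\<^sub>1, \<dots>, a\<^sub>n]\<close> is the finite continued fraction \<open>[0; a\<^sub>1, \<dots>, a\<^sub>n]\<close>.\<close>

fun cfrac_list :: "nat list \<Rightarrow> real" where
  "cfrac_list [] = 0"
| "cfrac_list (a # as) = 1 / (real a + cfrac_list as)"

text \<open>\<open>x = [0; a\<^sub>1, a\<^sub>2, \<dots>]\<close>.  Sequences are indexed from \<open>0\<close>, so \<open>a i\<close> is the partial quotient
  usually written \<open>a\<^bsub>i+1\<^esub>\<close>; the same holds for digits below.\<close>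

definition has_cfrac :: "real \<Rightarrow> (nat \<Rightarrow> nat) \<Rightarrow> bool" where
  "has_cfrac x a \<longleftrightarrow> (\<forall>i. 0 < a i) \<and> (\<lambda>n. cfrac_list (map a [0..<n])) \<longlonglongrightarrow> x"

text \<open>\<open>x = (0.d\<^sub>1d\<^sub>2d\<^sub>3\<dots>)\<^sub>b\<close>.\<close>

definition has_base_expansion :: "nat \<Rightarrow> real \<Rightarrow> nat stream \<Rightarrow> bool" where
  "has_base_expansion b x d \<longleftrightarrow>
     (\<forall>k. d !! k < b) \<and> (\<lambda>k. real (d !! k) / real b ^ Suc k) sums x"

definition trott_numbers :: "nat \<Rightarrow> real set" where
  "trott_numbers b = {x. 0 < x \<and> x < 1 \<and>
     (\<exists>a. has_cfrac x a \<and>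
          has_base_expansion b x (flat (smap (\<lambda>i. base_digits b (a i)) nats)))}"

definition nowhere_dense :: "'a::topological_space set \<Rightarrow> bool" where
  "nowhere_dense S \<longleftrightarrow> interior (closure S) = {}"

text \<open>The weight \<open>(diam U)\<^sup>s\<close> of a covering set, with the usual conventions that the empty set
  has weight \<open>0\<close> and that \<open>0\<^sup>0 = 1\<close> (whereas \<open>0 powr 0 = 0\<close>).\<close>

definition diam_weight :: "real \<Rightarrow> 'a::metric_space set \<Rightarrow> ennreal" where
  "diam_weight s U =
     (if U = {} then 0 else if s = 0 then 1 else ennreal (diameter U powr s))"

text \<open>Boundedness is required explicitly because \<^const>\<open>diameter\<close> is unspecified on unbounded
  sets.\<close>

definition delta_covers :: "real \<Rightarrow> 'a::metric_space set \<Rightarrow> (nat \<Rightarrow> 'a set) set" where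
  "delta_covers \<delta> A =
     {U. A \<subseteq> (\<Union>i. U i) \<and> (\<forall>i. bounded (U i) \<and> diameter (U i) \<le> \<delta>)}"

definition hausdorff_measure :: "real \<Rightarrow> 'a::metric_space set \<Rightarrow> ennreal" where
  "hausdorff_measure s A =
     (SUP \<delta>\<in>{0<..}. INF U\<in>delta_covers \<delta> A. \<Sum>i. diam_weight s (U i))"

text \<open>Valued in the extended nonnegative reals, so that the infimum of the empty set is \<open>\<infinity>\<close>.\<close>

definition hausdorff_dim :: "'a::metric_space set \<Rightarrow> ennreal" where
  "hausdorff_dim A = (INF s\<in>{s. 0 \<le> s \<and> hausdorff_measure s A = 0}. ennreal s)"

end

theory Submission
  imports Defs
begin

text \<open>Let \<open>w\<close> be the first \<open>n\<close> partial quotients of \<open>x\<close>, with \<open>n\<close> even, and \<open>c\<close> the next one. As a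
  continued fraction, \<open>x\<close> decreases in \<open>c\<close>; as a base-\<open>b\<close> expansion, it increases in \<open>c\<close> among all
  \<open>c\<close> with a given number of digits. Hence after a prefix of even length at most one \<open>c\<close> of each digit
  length occurs. Cover \<open>T\<^sub>b\<close> by continued fraction cylinders. The lengths of all children of a cylinder
  add up to the length of the cylinder, while for even \<open>n\<close> those of the children that occur add up to
  at most \<open>9/10\<close> of it, because the \<open>c\<close>-th child has relative length at most \<open>2/(c + 1)\<^sup>2\<close> and
  \<open>c \<ge> 2 ^ (k - 1)\<close> when it has \<open>k\<close> digits. With the exponent lowered slightly below \<open>1\<close>, the
  product of two consecutive factors stays below \<open>1\<close>, uniformly in \<open>b\<close>; so a single exponent
  serves all bases. The same gaps make each \<open>T\<^sub>b\<close> nowhere dense, and only finitely many bases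
  contribute to \<open>T\<close> outside a neighbourhood of \<open>0\<close>.\<close>

subsection \<open>Finite continued fractions with a tail\<close>

text \<open>As a function of \<open>y\<close>, an inverse branch of an iterate of the Gauss map.
  Every number whose infinite expansion starts with \<open>w\<close> is its value at some
  \<open>y\<close> with \<open>0 < y < 1\<close>, so the values at 0 and 1 bound the cylinder of
  \<open>w\<close>.\<close>

fun cfrac_tail :: "nat list \<Rightarrow> real \<Rightarrow> real" where
  "cfrac_tail [] y = y"
| "cfrac_tail (a # as) y = 1 / (real a + cfrac_tail as y)"

lemma cfrac_tail_append: "cfrac_tail (v @ w) y = cfrac_tail v (cfrac_tail w y)"
  by (induction v) auto

lemma cfrac_tail_nonneg: "0 \<le> y \<Longrightarrow> 0 \<le> cfrac_tail w y"
  by (induction w) auto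

lemma cfrac_tail_bounds:
  assumes "0 < y" "y < 1" "0 \<notin> set w"
  shows "0 < cfrac_tail w y" "cfrac_tail w y < 1"
proof -
  have "0 < cfrac_tail w y \<and> cfrac_tail w y < 1"
    using assms by (induction w) (auto simp: field_simps)
  then show "0 < cfrac_tail w y" "cfrac_tail w y < 1" by auto
qed

lemma continuous_on_cfrac_tail:
  assumes "0 \<notin> set w"
  shows "continuous_on {0..} (cfrac_tail w)"
  using assms
proof (induction w)
  case (Cons a w)
  have "real a + cfrac_tail w y \<noteq> 0" if "y \<in> {0..}" for y
    using cfrac_tail_nonneg[of y w] that Cons.prems by auto
  then show ?case
    using Cons by (auto intro!: continuous_intros)
qed (simp add: continuous_on_id)

text \<open>Each level \<open>1 / (a + _)\<close> reverses the order, so the parity of the number of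
  levels decides. Even length is later set against the digits, whose order is never
  reversed.\<close>

lemma cfrac_tail_strict_mono:
  assumes "0 \<notin> set w" "0 \<le> u" "u < v"
  shows "if even (length w) then cfrac_tail w u < cfrac_tail w v
         else cfrac_tail w v < cfrac_tail w u"
  using assms
proof (induction w)
  case (Cons a w)
  then have "0 < real a + cfrac_tail w u" "0 < real a + cfrac_tail w v"
    using cfrac_tail_nonneg[of u w] cfrac_tail_nonneg[of v w] by auto
  with Cons show ?case by (auto simp: divide_strict_left_mono)
qed simp

text \<open>A word acts as a product of integer matrices of determinant -1. Here
  \<open>p / q\<close> is the convergent of \<open>w\<close>, while \<open>p'\<close> and
  \<open>q'\<close> belong to the preceding convergent.\<close>

lemma cfrac_tail_moebius:
  assumes "0 \<notin> set w"
  obtains p p' q q' :: real where "0 < q" "0 \<le> q'" "q' \<le> q" "\<bar>p' * q - p * q'\<bar> = 1"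
    "\<And>y. 0 \<le> y \<Longrightarrow> cfrac_tail w y = (p + p' * y) / (q + q' * y)"
  using assms
proof (induction w arbitrary: thesis rule: rev_induct)
  case Nil
  show ?case by (rule Nil(1)[of 1 0 1 0]) auto
next
  case (snoc a w)
  from snoc.prems(2) have a: "1 \<le> real a" "0 \<notin> set w" by (cases a; auto)+
  obtain p p' q q' :: real where *: "0 < q" "0 \<le> q'" "q' \<le> q" "\<bar>p' * q - p * q'\<bar> = 1"
    and G: "\<And>y. 0 \<le> y \<Longrightarrow> cfrac_tail w y = (p + p' * y) / (q + q' * y)"
    using snoc.IH a(2) by metis
  \<comment> \<open>Recurrence of the convergents: appending \<open>a\<close> turns \<open>q\<close>
    into \<open>q * a + q'\<close> and the old \<open>q\<close> takes the place of
    \<open>q'\<close>; likewise for \<open>p\<close>. The determinant changes sign.\<close>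
  show ?case
  proof (rule snoc.prems(1)[of "q * a + q'" q p "p * a + p'"])
    have "q * 1 \<le> q * a" using * a by (intro mult_left_mono) auto
    then show "0 < q * a + q'" "q \<le> q * a + q'" using * by linarith+
    show "0 \<le> q" using * by simp
    have "p * (q * a + q') - (p * a + p') * q = - (p' * q - p * q')" by (simp add: algebra_simps)
    then show "\<bar>p * (q * a + q') - (p * a + p') * q\<bar> = 1" using *(4) by simp
    fix y :: real assume y: "0 \<le> y"
    then have ay: "0 < a + y" using a by linarith
    have "cfrac_tail (w @ [a]) y = (p + p' * (1 / (a + y))) / (q + q' * (1 / (a + y)))"
      using ay by (simp add: cfrac_tail_append G)
    also have "\<dots> = ((p + p' * (1 / (a + y))) * (a + y)) / ((q + q' * (1 / (a + y))) * (a + y))"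
      using ay by simp
    also have "\<dots> = (p * a + p' + p * y) / (q * a + q' + q * y)"
      using ay by (simp add: distrib_right) (simp add: algebra_simps)
    finally show "cfrac_tail (w @ [a]) y = (p * a + p' + p * y) / (q * a + q' + q * y)" .
  qed
qed

section \<open>Lengths of cylinders and of their children\<close>

definition cylinder_length :: "nat list \<Rightarrow> real" where
  "cylinder_length w = \<bar>cfrac_tail w 0 - cfrac_tail w 1\<bar>"

text \<open>The length of the \<open>a\<close>-th child relative to its parent, where \<theta> is
  the quotient \<open>q' / q\<close> of consecutive convergent denominators of the parent.\<close>

definition cylinder_ratio :: "real \<Rightarrow> nat \<Rightarrow> real" where
  "cylinder_ratio \<theta> a = (1 + \<theta>) / ((a + \<theta>) * (a + 1 + \<theta>))"

text \<open>A Moebius map of determinant 1 or -1 scales \<open>u - v\<close> by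
  \<open>1 / ((q + q' * u) * (q + q' * v))\<close>, up to sign. One \<theta> serves all children,
  which allows summing over \<open>a\<close>.\<close>

lemma cylinder_length_snoc:
  assumes "0 \<notin> set w"
  obtains \<theta> where "0 \<le> \<theta>" "\<theta> \<le> 1"
    "\<And>a. 0 < a \<Longrightarrow> cylinder_length (w @ [a]) = cylinder_length w * cylinder_ratio \<theta> a"
proof -
  obtain p p' q q' :: real where *: "0 < q" "0 \<le> q'" "q' \<le> q" "\<bar>p' * q - p * q'\<bar> = 1"
    and G: "\<And>y. 0 \<le> y \<Longrightarrow> cfrac_tail w y = (p + p' * y) / (q + q' * y)"
    using cfrac_tail_moebius[OF assms] by metis
  have diff: "\<bar>cfrac_tail w u - cfrac_tail w v\<bar> = \<bar>u - v\<bar> / ((q + q' * u) * (q + q' * v))"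
    if "0 \<le> u" "0 \<le> v" for u v
  proof -
    have pos: "0 < q + q' * u" "0 < q + q' * v" using * that by (auto intro: add_pos_nonneg)
    have "cfrac_tail w u - cfrac_tail w v
        = (p' * q - p * q') * (u - v) / ((q + q' * u) * (q + q' * v))"
      using pos by (simp add: G that diff_frac_eq) (simp add: algebra_simps)
    then show ?thesis using pos *(4) by (simp add: abs_mult)
  qed
  show thesis
  proof (rule that[of "q' / q"])
    fix a :: nat assume "0 < a"
    then have a: "1 \<le> real a" by simp
    \<comment> \<open>The child corresponds to the tails between \<open>1 / (a + 1)\<close> and
      \<open>1 / a\<close>.\<close>
    have len: "cylinder_length (w @ [a])
        = \<bar>1 / a - 1 / (real a + 1)\<bar> / ((q + q' * (1 / a)) * (q + q' * (1 / (real a + 1))))"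
      using diff[of "1 / a" "1 / (real a + 1)"] by (simp add: cylinder_length_def cfrac_tail_append add.commute)
    have 1: "\<bar>1 / real a - 1 / (real a + 1)\<bar> = 1 / (real a * (real a + 1))"
      using a by (simp add: field_simps)
    have 2: "q + q' * (1 / c) = q * (c + q' / q) / c" if "0 < c" for c
      using that * by (simp add: field_simps)
    have len': "cylinder_length w = 1 / (q * (q * (1 + q' / q)))"
    proof -
      have "q + q' = q * (1 + q' / q)" using * by (simp add: field_simps)
      then show ?thesis using diff[of 0 1] by (simp add: cylinder_length_def)
    qed
    have alg: "1 / (s * t) / ((q * A / s) * (q * B / t)) = 1 / (q * (q * C)) * (C / (A * B))"
      if "0 < s" "0 < t" "0 < A" "0 < B" "0 < C" for s t A B C :: real
      using that *(1) by (simp add: field_simps)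
    have "0 \<le> q' / q" "0 < real a" "0 < real a + 1" using a * by auto
    then show "cylinder_length (w @ [a]) = cylinder_length w * cylinder_ratio (q' / q) a"
      unfolding len 1 len' cylinder_ratio_def 2[OF \<open>0 < real a\<close>] 2[OF \<open>0 < real a + 1\<close>]
      by (intro alg add_pos_nonneg) auto
  qed (use * in auto)
qed

lemma cylinder_length_pos: "0 \<notin> set w \<Longrightarrow> 0 < cylinder_length w"
  using cfrac_tail_strict_mono[of w 0 1] by (auto simp: cylinder_length_def split: if_splits)

lemma cfrac_tail_in_cylinder:
  assumes "0 \<notin> set w" "0 \<le> y" "y \<le> 1"
  shows "cfrac_tail w y
    \<in> {min (cfrac_tail w 0) (cfrac_tail w 1)..max (cfrac_tail w 0) (cfrac_tail w 1)}"
  using assms cfrac_tail_strict_mono[of w 0 y] cfrac_tail_strict_mono[of w y 1]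
  by (cases "y = 0"; cases "y = 1") (auto split: if_splits)

subsection \<open>Infinite continued fractions\<close>

lemma cfrac_list_bounds:
  assumes "0 \<notin> set w"
  shows "0 \<le> cfrac_list w" "cfrac_list w \<le> 1"
proof -
  have "0 \<le> cfrac_list w \<and> cfrac_list w \<le> 1"
    using assms
  proof (induction w)
    case (Cons a w)
    then have "1 \<le> real a + cfrac_list w" by (cases a) auto
    then show ?case by (auto simp: field_simps)
  qed simp
  then show "0 \<le> cfrac_list w" "cfrac_list w \<le> 1" by auto
qed

lemma has_cfrac_pos:
  assumes "has_cfrac x a"
  shows "0 < x"
proof -
  have a: "0 < a i" for i using assms by (simp add: has_cfrac_def)
  \<comment> \<open>The first quotient alone keeps all nonempty convergents, hence also their limit,
    away from 0.\<close>
  have "1 / (real (a 0) + 1) \<le> cfrac_list (map a [0..<n])" if "n \<ge> 1" for n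
  proof -
    have n: "[0..<n] = 0 # [1..<n]" using that by (simp add: upt_conv_Cons)
    have "0 \<notin> set (map a [1..<n])" using a by (auto simp: image_iff)
    from cfrac_list_bounds[OF this] show ?thesis
      using a[of 0] by (auto simp: n intro!: divide_left_mono mult_pos_pos add_pos_nonneg)
  qed
  then have "1 / (real (a 0) + 1) \<le> x"
    using assms by (intro LIMSEQ_le_const[of "\<lambda>n. cfrac_list (map a [0..<n])"])
      (auto simp: has_cfrac_def)
  moreover have "0 < 1 / (real (a 0) + 1)" by (auto intro!: divide_pos_pos add_nonneg_pos)
  ultimately show ?thesis by linarith
qed

text \<open>Solving the recursion for the convergents of the shifted sequence expresses them by
  those of \<open>x\<close>; the reciprocal passes to the limit because \<open>x\<close> is
  positive.\<close>

lemma has_cfrac_Suc: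
  assumes "has_cfrac x a"
  obtains y where "has_cfrac y (a \<circ> Suc)" "x = 1 / (real (a 0) + y)"
proof
  let ?y = "1 / x - real (a 0)"
  have x: "0 < x" using assms by (rule has_cfrac_pos)
  have "cfrac_list (map (a \<circ> Suc) [0..<n]) = 1 / cfrac_list (map a [0..<Suc n]) - real (a 0)" for n
    by (simp add: map_upt_Suc o_def del: upt_Suc)
  moreover have "(\<lambda>n. 1 / cfrac_list (map a [0..<Suc n]) - real (a 0)) \<longlonglongrightarrow> ?y"
    using assms x unfolding has_cfrac_def
    by (intro tendsto_intros LIMSEQ_Suc) auto
  ultimately show "has_cfrac ?y (a \<circ> Suc)"
    using assms by (simp add: has_cfrac_def)
  show "x = 1 / (real (a 0) + ?y)" by simp
qed

lemma has_cfrac_less_1: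
  assumes "has_cfrac x a"
  shows "x < 1"
proof -
  obtain y where y: "has_cfrac y (a \<circ> Suc)" "x = 1 / (real (a 0) + y)"
    using has_cfrac_Suc[OF assms] .
  have "0 < a 0" using assms by (simp add: has_cfrac_def)
  then have "1 < real (a 0) + y" using has_cfrac_pos[OF y(1)] by linarith
  then show ?thesis using y(2) by simp
qed

lemma has_cfrac_tail:
  assumes "has_cfrac x a"
  obtains y where "has_cfrac y (\<lambda>i. a (n + i))" "x = cfrac_tail (map a [0..<n]) y"
proof -
  have "\<exists>y. has_cfrac y (\<lambda>i. a (n + i)) \<and> x = cfrac_tail (map a [0..<n]) y"
  proof (induction n)
    case 0
    then show ?case using assms by auto
  next
    case (Suc n)
    then obtain y where y: "has_cfrac y (\<lambda>i. a (n + i))" "x = cfrac_tail (map a [0..<n]) y"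
      by auto
    obtain z where "has_cfrac z ((\<lambda>i. a (n + i)) \<circ> Suc)" "y = 1 / (real (a (n + 0)) + z)"
      using has_cfrac_Suc[OF y(1)] .
    with y(2) show ?case by (intro exI[of _ z]) (auto simp: cfrac_tail_append o_def)
  qed
  with that show thesis by auto
qed

text \<open>The two tails lie strictly between 0 and 1, so quotients can be read off as integer
  parts. This later excludes Trott numbers from the open cylinder of a word that is no
  prefix.\<close>

lemma has_cfrac_prefix_unique:
  assumes "has_cfrac (cfrac_tail w y) a" "0 < y" "y < 1" "0 \<notin> set w"
  shows "map a [0..<length w] = w"
  using assms
proof (induction w arbitrary: a)
  case (Cons b w)
  obtain z where z: "has_cfrac z (a \<circ> Suc)" "cfrac_tail (b # w) y = 1 / (real (a 0) + z)"
    using has_cfrac_Suc[OF Cons.prems(1)] .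
  have bounds: "0 < z" "z < 1" "0 < cfrac_tail w y" "cfrac_tail w y < 1"
    using has_cfrac_pos[OF z(1)] has_cfrac_less_1[OF z(1)] cfrac_tail_bounds[of y w] Cons.prems
    by auto
  have eq: "real b + cfrac_tail w y = real (a 0) + z" using z(2) by simp
  then have "\<bar>real b - real (a 0)\<bar> < 1" using bounds by linarith
  then have ab: "a 0 = b" by linarith
  with eq have "cfrac_tail w y = z" by simp
  with Cons z(1) have "map (a \<circ> Suc) [0..<length w] = w" by simp
  with ab show ?case by (simp add: map_upt_Suc o_def del: upt_Suc)
qed simp

subsection \<open>Concatenated digits\<close>

text \<open>The base-\<open>b\<close> counterpart of \<open>cfrac_tail\<close>, increasing in
  \<open>z\<close> whatever the number of digits.\<close>

fun digits_tail :: "nat \<Rightarrow> nat list \<Rightarrow> real \<Rightarrow> real" where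
  "digits_tail b [] z = z"
| "digits_tail b (d # ds) z = (real d + digits_tail b ds z) / real b"

lemma digits_tail_append: "digits_tail b (ds @ es) z = digits_tail b ds (digits_tail b es z)"
  by (induction ds) auto

lemma digits_tail_mono: "z \<le> z' \<Longrightarrow> digits_tail b ds z \<le> digits_tail b ds z'"
  by (induction ds) (auto simp: divide_right_mono)

lemma has_base_expansion_bounds:
  assumes "has_base_expansion b x d" "2 \<le> b"
  shows "0 \<le> x" "x \<le> 1"
proof -
  have d: "\<And>k. d !! k < b" and s: "(\<lambda>k. real (d !! k) / real b ^ Suc k) sums x"
    using assms by (auto simp: has_base_expansion_def)
  show "0 \<le> x" using s by (rule sums_le[OF _ sums_zero, rotated]) auto
  \<comment> \<open>Comparison with the expansion all of whose digits are \<open>b - 1\<close>. It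
    is admissible and has value 1, so the bound cannot be strict.\<close>
  have "(\<lambda>k. (1 / real b) ^ k) sums (1 / (1 - 1 / real b))"
    using assms(2) by (intro geometric_sums) auto
  from sums_mult[OF this, of "(real b - 1) / real b"]
  have g: "(\<lambda>k. (real b - 1) / real b * (1 / real b) ^ k) sums 1"
    using assms(2) by (simp add: field_simps)
  have "real (d !! k) / real b ^ Suc k \<le> (real b - 1) / real b * (1 / real b) ^ k" for k
  proof -
    have "real (d !! k) \<le> real b - 1" using d[of k] by linarith
    then show ?thesis using assms(2) by (simp add: field_simps)
  qed
  then show "x \<le> 1" by (rule sums_le[OF _ s g])
qed

lemma has_base_expansion_shift:
  assumes "has_base_expansion b x (ds @- s)" "2 \<le> b"
  obtains z where "has_base_expansion b z s" "x = digits_tail b ds z"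
proof -
  have "\<exists>z. has_base_expansion b z s \<and> x = digits_tail b ds z"
    using assms(1)
  proof (induction ds arbitrary: x)
    case (Cons d ds)
    let ?t = "ds @- s"
    have d: "\<And>k. (d ## ?t) !! k < b"
      and sx: "(\<lambda>k. real ((d ## ?t) !! k) / real b ^ Suc k) sums x"
      using Cons.prems by (auto simp: has_base_expansion_def)
    from sx have "(\<lambda>k. real (?t !! k) / real b ^ Suc (Suc k)) sums (x - real d / real b)"
      using sums_Suc_iff[of "\<lambda>k. real ((d ## ?t) !! k) / real b ^ Suc k" "x - real d / real b"]
      by simp
    from sums_mult[OF this, of "real b"]
    have "(\<lambda>k. real (?t !! k) / real b ^ Suc k) sums (real b * x - real d)"
      using assms(2) by (simp add: right_diff_distrib)
    moreover have "?t !! k < b" for k using d[of "Suc k"] by simp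
    ultimately have "has_base_expansion b (real b * x - real d) ?t"
      by (simp add: has_base_expansion_def)
    from Cons.IH[OF this] obtain z
      where z: "has_base_expansion b z s" "real b * x - real d = digits_tail b ds z" by auto
    then have "x = digits_tail b (d # ds) z" using assms(2) by (simp add: field_simps flip: z(2))
    with z(1) show ?case by blast
  qed auto
  with that show thesis by auto
qed

lemma base_digits_nonempty: "base_digits b n \<noteq> []"
  by (subst base_digits.simps) simp

text \<open>Horner's scheme. Once the digit length is fixed, the value increases with
  \<open>n\<close>; a change of length would change the denominator.\<close>

lemma digits_tail_base_digits:
  assumes "2 \<le> b"
  shows "digits_tail b (base_digits b n) z = (real n + z) / real b ^ length (base_digits b n)"
proof (induction b n arbitrary: z rule: base_digits.induct)
  case (1 b n)
  show ?case
  proof (cases "b < 2 \<or> n < b")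
    case False
    then have "digits_tail b (base_digits b n) z
        = digits_tail b (base_digits b (n div b)) ((real (n mod b) + z) / real b)"
      by (subst base_digits.simps) (simp add: digits_tail_append)
    also have "\<dots> = (real (n div b) + (real (n mod b) + z) / real b)
        / real b ^ length (base_digits b (n div b))"
      using 1 False by simp
    also have "\<dots> = (real (n div b * b + n mod b) + z)
        / real b ^ Suc (length (base_digits b (n div b)))"
      using assms unfolding of_nat_add of_nat_mult by (simp add: divide_simps algebra_simps)
    also have "Suc (length (base_digits b (n div b))) = length (base_digits b n)"
      using False by (subst (2) base_digits.simps) simp
    finally show ?thesis by simp
  qed (use assms in \<open>simp add: base_digits.simps\<close>)
qed

lemma base_digits_length:
  assumes "2 \<le> b" "0 < n"
  shows "b ^ (length (base_digits b n) - 1) \<le> n"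
  using assms
proof (induction b n rule: base_digits.induct)
  case (1 b n)
  show ?case
  proof (cases "n < b")
    case False
    let ?k = "length (base_digits b (n div b))"
    have "length (base_digits b n) - 1 = Suc (?k - 1)"
      using False 1(2) base_digits_nonempty[of b "n div b"] by (subst base_digits.simps) simp
    moreover have "b ^ (?k - 1) \<le> n div b"
      using 1 False by (simp add: div_greater_zero_iff)
    then have "b * b ^ (?k - 1) \<le> b * (n div b)" by simp
    then have "b * b ^ (?k - 1) \<le> n" by (rule order_trans) simp
    ultimately show ?thesis by simp
  qed (use 1 in \<open>simp add: base_digits.simps\<close>)
qed

subsection \<open>Prefixes of Trott numbers\<close>

text \<open>Splits the digit stream at a block boundary; nonempty blocks are what lets
  \<open>flat\<close> unfold block by block.\<close>

lemma flat_smap_nats: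
  assumes "\<And>i. f i \<noteq> []"
  shows "flat (smap f nats) = concat (map f [0..<n]) @- flat (smap (\<lambda>i. f (n + i)) nats)"
proof (induction n)
  case (Suc n)
  have "smap (\<lambda>i. f (n + i)) nats = f n ## smap (\<lambda>i. f (Suc n + i)) nats"
    by (subst siterate.ctr) (simp add: stream.map_comp o_def flip: smap_siterate)
  then have "flat (smap (\<lambda>i. f (n + i)) nats) = f n @- flat (smap (\<lambda>i. f (Suc n + i)) nats)"
    using assms by simp
  with Suc show ?case by simp
qed simp

definition trott_expansion :: "nat \<Rightarrow> real \<Rightarrow> (nat \<Rightarrow> nat) \<Rightarrow> bool" where
  "trott_expansion b x a \<longleftrightarrow>
     has_cfrac x a \<and> has_base_expansion b x (flat (smap (\<lambda>i. base_digits b (a i)) nats))"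

lemma trott_numbers_expansion: "x \<in> trott_numbers b \<longleftrightarrow> (\<exists>a. trott_expansion b x a)"
  using has_cfrac_pos has_cfrac_less_1 by (auto simp: trott_numbers_def trott_expansion_def)

text \<open>Exposes the same quotient \<open>a n\<close> in both descriptions of \<open>x\<close>,
  so that the continued fraction and the digits can be compared.\<close>

lemma trott_expansion_split:
  assumes "trott_expansion b x a" "2 \<le> b"
  obtains y z where "0 < y" "y < 1" "0 \<le> z" "z \<le> 1"
    "x = cfrac_tail (map a [0..<n]) (1 / (real (a n) + y))"
    "x = digits_tail b (concat (map (base_digits b) (map a [0..<n])))
           ((real (a n) + z) / real b ^ length (base_digits b (a n)))"
proof -
  let ?f = "\<lambda>i. base_digits b (a i)"
  have cf: "has_cfrac x a" and be: "has_base_expansion b x (flat (smap ?f nats))"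
    using assms by (auto simp: trott_expansion_def)
  obtain y where y: "has_cfrac y (\<lambda>i. a (Suc n + i))" "x = cfrac_tail (map a [0..<Suc n]) y"
    using has_cfrac_tail[OF cf] .
  have "flat (smap ?f nats) = concat (map ?f [0..<Suc n]) @- flat (smap (\<lambda>i. ?f (Suc n + i)) nats)"
    by (rule flat_smap_nats) (rule base_digits_nonempty)
  then obtain z where z: "has_base_expansion b z (flat (smap (\<lambda>i. ?f (Suc n + i)) nats))"
      "x = digits_tail b (concat (map ?f [0..<Suc n])) z"
    using has_base_expansion_shift be assms(2) by metis
  show thesis
  proof (rule that)
    show "0 < y" "y < 1" using has_cfrac_pos[OF y(1)] has_cfrac_less_1[OF y(1)] .
    show "0 \<le> z" "z \<le> 1" using has_base_expansion_bounds[OF z(1) assms(2)] .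
    show "x = cfrac_tail (map a [0..<n]) (1 / (real (a n) + y))"
      using y(2) by (simp add: cfrac_tail_append)
    show "x = digits_tail b (concat (map (base_digits b) (map a [0..<n])))
           ((real (a n) + z) / real b ^ length (base_digits b (a n)))"
      using z(2) assms(2)
      by (simp add: digits_tail_append digits_tail_base_digits o_def)
  qed
qed

definition trott_prefixes :: "nat \<Rightarrow> nat list set" where
  "trott_prefixes b = {w. \<exists>x a. trott_expansion b x a \<and> map a [0..<length w] = w}"

lemma trott_prefixes_pos: "w \<in> trott_prefixes b \<Longrightarrow> 0 \<notin> set w"
proof
  assume "w \<in> trott_prefixes b" "0 \<in> set w"
  then obtain x a where a: "trott_expansion b x a" "map a [0..<length w] = w"
    by (auto simp: trott_prefixes_def)
  have "0 \<in> set (map a [0..<length w])" using \<open>0 \<in> set w\<close> a(2) by simp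
  then show False using a(1) by (auto simp: trott_expansion_def has_cfrac_def) (metis less_irrefl)
qed

lemma trott_prefixes_snocD: "w @ [c] \<in> trott_prefixes b \<Longrightarrow> w \<in> trott_prefixes b"
  by (auto simp: trott_prefixes_def)

lemma trott_prefixes_even_unique:
  assumes "w @ [c] \<in> trott_prefixes b" "w @ [c'] \<in> trott_prefixes b" "2 \<le> b" "even (length w)"
    "length (base_digits b c) = length (base_digits b c')"
  shows "c = c'"
proof -
  have False if less: "c < c'" and mem: "w @ [c] \<in> trott_prefixes b" "w @ [c'] \<in> trott_prefixes b"
    and len: "length (base_digits b c) = length (base_digits b c')" for c c'
  proof -
    obtain x a where a: "trott_expansion b x a" "map a [0..<length w] = w" "a (length w) = c"
      using mem(1) by (auto simp: trott_prefixes_def)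
    obtain x' a' where a': "trott_expansion b x' a'" "map a' [0..<length w] = w" "a' (length w) = c'"
      using mem(2) by (auto simp: trott_prefixes_def)
    let ?E = "digits_tail b (concat (map (base_digits b) w))"
    let ?k = "length (base_digits b c)"
    obtain y z where y: "0 < y" "y < 1" and z: "0 \<le> z" "z \<le> 1"
      and x: "x = cfrac_tail w (1 / (real c + y))" "x = ?E ((real c + z) / real b ^ ?k)"
      using trott_expansion_split[OF a(1) assms(3), of "length w"] unfolding a(2,3) .
    obtain y' z' where y': "0 < y'" "y' < 1" and z': "0 \<le> z'" "z' \<le> 1"
      and x': "x' = cfrac_tail w (1 / (real c' + y'))" "x' = ?E ((real c' + z') / real b ^ ?k)"
      using trott_expansion_split[OF a'(1) assms(3), of "length w"] unfolding a'(2,3) len .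
    \<comment> \<open>As \<open>c + 1 <= c'\<close>, the tails cannot undo the order of
      \<open>c\<close> and \<open>c'\<close>. The digit side gives only a weak inequality;
      strictness on the continued fraction side suffices for a contradiction.\<close>
    have "real c + z \<le> real c' + z'" "real c + y < real c' + y'"
      using less y y' z z' by linarith+
    then have "x \<le> x'"
      unfolding x(2) x'(2) using assms(3) by (intro digits_tail_mono divide_right_mono) auto
    moreover have "1 / (real c' + y') < 1 / (real c + y)"
      using \<open>real c + y < real c' + y'\<close> y y' by (intro divide_strict_left_mono) auto
    then have "x' < x"
      unfolding x(1) x'(1) using cfrac_tail_strict_mono[of w] trott_prefixes_pos[OF mem(1)] assms(4) y'
      by auto
    ultimately show False by simp
  qed
  with assms show ?thesis by (metis linorder_less_linear)
qed

subsection \<open>Sums over cylinders\<close>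

text \<open>Nonnegative terms allow enlarging \<open>A\<close> to an initial segment of the positive
  integers, where the bound telescopes.\<close>

lemma sum_telescope_le:
  fixes f g :: "nat \<Rightarrow> real"
  assumes "finite A" "0 \<notin> A" "\<And>a. 0 \<le> g a" "\<And>a. 0 < a \<Longrightarrow> g a \<le> f a - f (Suc a)" "\<And>a. 0 \<le> f a"
  shows "sum g A \<le> f 1"
proof -
  obtain N where N: "A \<subseteq> {..<N}" using finite_nat_bounded[OF assms(1)] by blast
  have "A \<subseteq> {1..<Suc N}"
  proof
    fix a assume a: "a \<in> A"
    then have "a \<noteq> 0" using assms(2) by metis
    with a N show "a \<in> {1..<Suc N}" by auto
  qed
  then have "sum g A \<le> sum g {1..<Suc N}" using assms(3) by (intro sum_mono2) auto
  also have "\<dots> \<le> (\<Sum>a\<in>{1..<Suc N}. - f (Suc a) - (- f a))"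
    using assms(4) by (intro sum_mono) fastforce
  also have "\<dots> = - f (Suc N) - (- f 1)" by (rule sum_Suc_diff') simp
  also have "\<dots> \<le> f 1" using assms(5)[of "Suc N"] by simp
  finally show ?thesis .
qed

lemma cylinder_ratio_nonneg: "0 \<le> \<theta> \<Longrightarrow> 0 \<le> cylinder_ratio \<theta> a"
  by (simp add: cylinder_ratio_def)

lemma sum_cylinder_ratio_le_1:
  assumes "0 \<le> \<theta>" "finite A" "0 \<notin> A"
  shows "(\<Sum>a\<in>A. cylinder_ratio \<theta> a) \<le> 1"
proof -
  \<comment> \<open>The ratio is exactly \<open>f a - f (Suc a)\<close>: the children tile the
    parent.\<close>
  define f where "f a = (1 + \<theta>) / (real a + \<theta>)" for a :: nat
  have "cylinder_ratio \<theta> a \<le> f a - f (Suc a)" if "0 < a" for a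
  proof -
    have "0 < real a + \<theta>" "0 < real a + 1 + \<theta>" using assms that by auto
    then show ?thesis
      unfolding cylinder_ratio_def f_def by (simp add: divide_simps) (simp add: algebra_simps)
  qed
  then have "(\<Sum>a\<in>A. cylinder_ratio \<theta> a) \<le> f 1"
    using assms by (intro sum_telescope_le cylinder_ratio_nonneg) (auto simp: f_def)
  also have "f 1 = 1" using assms(1) by (simp add: f_def)
  finally show ?thesis .
qed

text \<open>For \<open>a >= 1\<close>, the factor \<open>(1 + \<theta>) / (a + \<theta>)\<close> is
  largest at \<theta> = 1 and \<open>1 / (a + 1 + \<theta>)\<close> at \<theta> = 0.\<close>

lemma cylinder_ratio_le:
  assumes "0 \<le> \<theta>" "\<theta> \<le> 1" "0 < a"
  shows "cylinder_ratio \<theta> a \<le> 2 / (real a + 1)\<^sup>2"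
proof -
  have a: "1 \<le> real a" using assms by simp
  have "0 \<le> (1 - \<theta>) * (real a - 1)" using assms a by (intro mult_nonneg_nonneg) auto
  then have "(1 + \<theta>) * (real a + 1) \<le> 2 * (real a + \<theta>)" by (simp add: algebra_simps)
  then have "(1 + \<theta>) / (real a + \<theta>) \<le> 2 / (real a + 1)"
    using a assms by (simp add: divide_simps)
  moreover have "1 / (real a + 1 + \<theta>) \<le> 1 / (real a + 1)"
    using a assms by (intro divide_left_mono) auto
  ultimately have "(1 + \<theta>) / (real a + \<theta>) * (1 / (real a + 1 + \<theta>)) \<le> 2 / (real a + 1) * (1 / (real a + 1))"
    using a assms by (intro mult_mono) auto
  then show ?thesis by (simp add: cylinder_ratio_def power2_eq_square)
qed

text \<open>The factor \<open>1 + t \<surd>(a + 1)\<close> comes from \<open>1/r \<le> (a + 1)\<^sup>2 = Y\<^sup>4\<close> with \<open>Y = \<surd>(a + 1)\<close> and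
  \<open>Y powr t \<le> 1 + t Y\<close>.\<close>

lemma cylinder_ratio_powr_le:
  assumes "0 \<le> \<theta>" "\<theta> \<le> 1" "0 < a" "0 < t" "t < 1"
  shows "cylinder_ratio \<theta> a powr (1 - t / 4) \<le> cylinder_ratio \<theta> a * (1 + t * sqrt (real a + 1))"
proof -
  define r where "r = cylinder_ratio \<theta> a"
  define Y where "Y = sqrt (real a + 1)"
  have a: "1 \<le> real a" using assms by simp
  then have Y: "0 < Y" by (simp add: Y_def)
  have r: "0 < r" using assms a by (simp add: r_def cylinder_ratio_def)
  have "real a + \<theta> \<le> real a + 1" "real a + 1 + \<theta> \<le> (real a + 1) * (1 + \<theta>)"
    using a assms by (auto simp: algebra_simps)
  then have "(real a + \<theta>) * (real a + 1 + \<theta>) \<le> (real a + 1) * ((real a + 1) * (1 + \<theta>))"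
    using a assms by (intro mult_mono) auto
  then have "1 / r \<le> (real a + 1)\<^sup>2"
    using a assms by (simp add: r_def cylinder_ratio_def divide_simps power2_eq_square algebra_simps)
  also have "real a + 1 = Y powr 2" using a by (simp add: Y_def)
  finally have "1 / r \<le> Y powr 4" using Y by (simp add: powr_powr flip: powr_numeral)
  then have "(1 / r) powr (t / 4) \<le> (Y powr 4) powr (t / 4)"
    using assms r by (intro powr_mono2) auto
  also have "\<dots> = Y powr t * 1 powr (1 - t)" by (simp add: powr_powr)
  also have "\<dots> \<le> t * Y + (1 - t) * 1" using assms Y by (intro Youngs_inequality_0) auto
  also have "\<dots> \<le> 1 + t * Y" using assms by simp
  finally have "(1 / r) powr (t / 4) \<le> 1 + t * Y" .
  moreover have "r powr (1 - t / 4) = r * (1 / r) powr (t / 4)"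
    using r by (simp add: powr_diff powr_divide)
  ultimately show ?thesis
    using r by (simp add: mult_left_mono flip: r_def Y_def)
qed

text \<open>The terms are at most \<open>2 / (a + 1)\<close> to the power 3/2 in the denominator,
  and these are dominated by the differences of \<open>4 / sqrt a\<close>, whose sum telescopes to
  at most 4.\<close>

lemma sum_cylinder_ratio_sqrt_le:
  assumes "0 \<le> \<theta>" "\<theta> \<le> 1" "finite A" "0 \<notin> A"
  shows "(\<Sum>a\<in>A. cylinder_ratio \<theta> a * sqrt (real a + 1)) \<le> 4"
proof -
  define f where "f a = 4 / sqrt (real a)" for a
  have le: "cylinder_ratio \<theta> a * sqrt (real a + 1) \<le> f a - f (Suc a)" if "0 < a" for a
  proof -
    define u v where "u = sqrt (real a)" and "v = sqrt (real a + 1)"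
    have uv: "0 < u" "u \<le> v" "u\<^sup>2 = real a" "v\<^sup>2 = real a + 1" using that by (auto simp: u_def v_def)
    have "cylinder_ratio \<theta> a * v \<le> 2 / (v\<^sup>2)\<^sup>2 * v"
      using cylinder_ratio_le[OF assms(1,2) that] uv by (intro mult_right_mono) auto
    also have "\<dots> = 2 / v^3" using uv(1,2) by (simp add: power2_eq_square power3_eq_cube)
    also have "\<dots> \<le> 4 / u - 4 / v"
    proof -
      have "(v - u) * (v + u) = 1" using uv by (simp add: algebra_simps power2_eq_square)
      then have d: "v - u = 1 / (v + u)" using uv by (simp add: field_simps)
      have "4 / u - 4 / v = 4 * (v - u) / (u * v)" using uv by (simp add: field_simps)
      also have "\<dots> = 4 / (u * v * (v + u))" unfolding d by simp
      also have "\<dots> \<ge> 4 / (v * v * (v + v))"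
        using uv by (intro divide_left_mono mult_mono mult_pos_pos) auto
      finally show ?thesis using uv by (simp add: power3_eq_cube)
    qed
    finally show ?thesis by (simp add: f_def u_def v_def add.commute)
  qed
  have "(\<Sum>a\<in>A. cylinder_ratio \<theta> a * sqrt (real a + 1)) \<le> f 1"
    using assms le by (intro sum_telescope_le mult_nonneg_nonneg cylinder_ratio_nonneg) (auto simp: f_def)
  then show ?thesis by (simp add: f_def)
qed

text \<open>Lowering the exponent by \<open>t / 4\<close> costs at most \<open>4 * t\<close>,
  uniformly in \<theta> and \<open>A\<close>.\<close>

lemma sum_cylinder_ratio_powr_le:
  assumes "0 \<le> \<theta>" "\<theta> \<le> 1" "finite A" "0 \<notin> A" "0 < t" "t < 1"
  shows "(\<Sum>a\<in>A. cylinder_ratio \<theta> a powr (1 - t / 4)) \<le> (\<Sum>a\<in>A. cylinder_ratio \<theta> a) + 4 * t"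
proof -
  have "(\<Sum>a\<in>A. cylinder_ratio \<theta> a powr (1 - t / 4))
      \<le> (\<Sum>a\<in>A. cylinder_ratio \<theta> a * (1 + t * sqrt (real a + 1)))"
    using assms by (intro sum_mono cylinder_ratio_powr_le) (auto intro!: Nat.gr0I)
  also have "\<dots> = (\<Sum>a\<in>A. cylinder_ratio \<theta> a)
      + t * (\<Sum>a\<in>A. cylinder_ratio \<theta> a * sqrt (real a + 1))"
    by (simp add: distrib_left sum.distrib sum_distrib_left algebra_simps)
  also have "t * (\<Sum>a\<in>A. cylinder_ratio \<theta> a * sqrt (real a + 1)) \<le> t * 4"
    using sum_cylinder_ratio_sqrt_le[OF assms(1-4)] assms(5) by (intro mult_left_mono) auto
  finally show ?thesis by (simp add: mult.commute)
qed

text \<open>Convexity, 3 being the midpoint of 2 and 4. It yields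
  \<open>2 / (2 ^ k + 1) <= (2 / 3) ^ k\<close>.\<close>

lemma two_mult_power_3_le: "2 * 3 ^ k \<le> (4::nat) ^ k + 2 ^ k"
proof (induction k)
  case (Suc k)
  have "(2::nat) ^ k \<le> 4 ^ k" by (rule power_mono) auto
  with Suc show ?case by simp
qed simp

text \<open>A geometric majorant of \<open>2 / (2 ^ k + 1)\<^sup>2\<close>, exact for
  \<open>k = 0\<close> and \<open>k = 1\<close>, where \<open>k\<close> is the digit length minus
  1.\<close>

lemma cylinder_ratio_digits_le:
  assumes "0 \<le> \<theta>" "\<theta> \<le> 1" "0 < a" "2 \<le> b"
  shows "cylinder_ratio \<theta> a \<le> 1 / 2 * (4 / 9) ^ (length (base_digits b a) - 1)"
proof -
  let ?k = "length (base_digits b a) - 1"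
  have "2 ^ ?k \<le> b ^ ?k" using assms by (intro power_mono) auto
  also have "\<dots> \<le> a" using assms by (intro base_digits_length) auto
  finally have "real (2 ^ ?k) \<le> real a" by (rule of_nat_mono)
  then have a: "2 ^ ?k \<le> real a" by simp
  have "real (2 * 3 ^ ?k) \<le> real (4 ^ ?k + 2 ^ ?k)" using two_mult_power_3_le of_nat_mono by blast
  also have "\<dots> = 2 ^ ?k * (2 ^ ?k + 1)" by (simp add: algebra_simps flip: power_mult_distrib)
  also have "\<dots> \<le> 2 ^ ?k * (real a + 1)" using a by simp
  finally have "2 / (real a + 1) \<le> (2 / 3) ^ ?k" by (simp add: field_simps power_divide)
  then have "(2 / (real a + 1))\<^sup>2 \<le> ((2 / 3) ^ ?k)\<^sup>2" by (intro power_mono) auto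
  also have "\<dots> = (4 / 9) ^ ?k" by (simp add: power2_eq_square flip: power_mult_distrib)
  finally have "2 / (real a + 1)\<^sup>2 \<le> 1 / 2 * (4 / 9) ^ ?k" by (simp add: power_divide)
  with cylinder_ratio_le[OF assms(1-3)] show ?thesis by linarith
qed

lemma sum_cylinder_ratio_distinct_lengths:
  assumes "0 \<le> \<theta>" "\<theta> \<le> 1" "finite A" "0 \<notin> A" "2 \<le> b"
    "inj_on (\<lambda>a. length (base_digits b a)) A"
  shows "(\<Sum>a\<in>A. cylinder_ratio \<theta> a) \<le> 9 / 10"
proof -
  let ?k = "\<lambda>a. length (base_digits b a) - 1"
  have inj: "inj_on ?k A"
    using assms(6) base_digits_nonempty
    by (auto simp: inj_on_def) (metis One_nat_def Suc_pred length_greater_0_conv)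
  have "(\<Sum>a\<in>A. cylinder_ratio \<theta> a) \<le> (\<Sum>a\<in>A. 1 / 2 * (4 / 9) ^ ?k a)"
    using assms by (intro sum_mono cylinder_ratio_digits_le) (auto intro!: Nat.gr0I)
  also have "\<dots> = 1 / 2 * (\<Sum>k\<in>?k ` A. (4 / 9) ^ k)"
    unfolding sum.reindex[OF inj] by (simp add: sum_distrib_left)
  \<comment> \<open>Distinct lengths make each power occur at most once, so the full series, of
    value 9/5, is a bound.\<close>
  also have "\<dots> \<le> 1 / 2 * (\<Sum>k. (4 / 9 :: real) ^ k)"
    using assms(3) by (intro mult_left_mono sum_le_suminf summable_geometric) auto
  also have "\<dots> = 9 / 10" by (subst suminf_geometric) auto
  finally show ?thesis .
qed

section \<open>The lowered exponent and the decay of the covering sums\<close>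

text \<open>The choice \<open>t = 1/100\<close> turns the step factors \<open>9/10 + 4 t\<close> and \<open>1 + 4 t\<close> into \<open>94/100\<close> and
  \<open>104/100\<close>.\<close>

definition trott_exponent :: real where
  "trott_exponent = 1 - (1 / 100) / 4"

primrec cover_bound :: "nat \<Rightarrow> real" where
  "cover_bound 0 = 1"
| "cover_bound (Suc n) = (if even n then 94 / 100 else 104 / 100) * cover_bound n"

text \<open>Two consecutive steps contribute 0.94 * 1.04 = 0.9776 < 1, so the bound tends to 0 along
  even lengths.\<close>

lemma cover_bound_double: "cover_bound (2 * m) = (94 / 100 * (104 / 100)) ^ m"
  by (induction m) auto

text \<open>Induction on the length, grouping words by their parents. A word may have infinitely
  many children, hence the restriction to finite families with a bound independent of the
  family.\<close>

lemma sum_cylinder_length_le: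
  assumes "finite F" "F \<subseteq> trott_prefixes b" "\<And>w. w \<in> F \<Longrightarrow> length w = n" "2 \<le> b"
  shows "(\<Sum>w\<in>F. cylinder_length w powr trott_exponent) \<le> cover_bound n"
  using assms(1-3)
proof (induction n arbitrary: F)
  case 0
  then have "F = {} \<or> F = {[]}" by auto
  then show ?case by (auto simp: cylinder_length_def)
next
  case (Suc n)
  define c where "c = (if even n then 94 / 100 else 104 / 100 :: real)"
  define V where "V = butlast ` F"
  define A where "A v = {a. v @ [a] \<in> F}" for v
  have snoc: "\<exists>v a. w = v @ [a]" if "w \<in> F" for w
    using Suc.prems(3)[OF that] by (cases w rule: rev_cases) auto
  have finV: "finite V" using Suc.prems by (simp add: V_def)
  have finA: "finite (A v)" for v
  proof -
    have "(\<lambda>a. v @ [a]) ` A v \<subseteq> F" by (auto simp: A_def)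
    then show ?thesis using Suc.prems(1) finite_subset finite_imageD
      by (metis (mono_tags) append1_eq_conv inj_onI)
  qed
  have V: "V \<subseteq> trott_prefixes b" "\<And>v. v \<in> V \<Longrightarrow> length v = n"
    using Suc.prems(2,3) snoc trott_prefixes_snocD by (fastforce simp: V_def)+
  have F: "F = (\<lambda>(v, a). v @ [a]) ` (SIGMA v:V. A v)"
    using snoc by (force simp: V_def A_def image_iff)
  have step: "(\<Sum>a\<in>A v. cylinder_length (v @ [a]) powr trott_exponent)
      \<le> c * cylinder_length v powr trott_exponent" if v: "v \<in> V" for v
  proof -
    have pos: "0 \<notin> set v" using trott_prefixes_pos V v by blast
    have A0: "0 \<notin> A v" using trott_prefixes_pos Suc.prems(2) by (fastforce simp: A_def)
    obtain \<theta> where \<theta>: "0 \<le> \<theta>" "\<theta> \<le> 1"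
      and len: "\<And>a. 0 < a \<Longrightarrow> cylinder_length (v @ [a]) = cylinder_length v * cylinder_ratio \<theta> a"
      using cylinder_length_snoc[OF pos] by blast
    \<comment> \<open>The only place where parity enters: the children of even words have distinct
      digit lengths. The summand \<open>4 * (1 / 100)\<close> pays for the lowered exponent.\<close>
    have "(\<Sum>a\<in>A v. cylinder_ratio \<theta> a) + 4 * (1 / 100) \<le> c"
    proof (cases "even n")
      case True
      have "inj_on (\<lambda>a. length (base_digits b a)) (A v)"
        using trott_prefixes_even_unique[of v _ b] True V(2)[OF v] Suc.prems(2) assms(4)
        by (fastforce simp: A_def inj_on_def)
      with sum_cylinder_ratio_distinct_lengths[OF \<theta> finA A0 assms(4)] show ?thesis
        using True by (simp add: c_def)
    next
      case False
      then show ?thesis using sum_cylinder_ratio_le_1[OF \<theta>(1) finA A0] by (simp add: c_def)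
    qed
    then have sum: "(\<Sum>a\<in>A v. cylinder_ratio \<theta> a powr trott_exponent) \<le> c"
      using sum_cylinder_ratio_powr_le[OF \<theta> finA A0, of "1 / 100"] unfolding trott_exponent_def
      by linarith
    have "(\<Sum>a\<in>A v. cylinder_length (v @ [a]) powr trott_exponent)
        = (\<Sum>a\<in>A v. cylinder_length v powr trott_exponent * cylinder_ratio \<theta> a powr trott_exponent)"
    proof (rule sum.cong)
      fix a assume "a \<in> A v"
      then have "0 < a" using A0 by (cases a) auto
      then show "cylinder_length (v @ [a]) powr trott_exponent
          = cylinder_length v powr trott_exponent * cylinder_ratio \<theta> a powr trott_exponent"
        using cylinder_length_pos[OF pos] cylinder_ratio_nonneg[OF \<theta>(1), of a]
        by (simp add: len powr_mult)
    qed simp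
    also have "\<dots> \<le> cylinder_length v powr trott_exponent * c"
      using sum by (simp add: mult_left_mono flip: sum_distrib_left)
    finally show ?thesis by (simp add: mult.commute)
  qed
  have "(\<Sum>w\<in>F. cylinder_length w powr trott_exponent)
      = (\<Sum>(v, a)\<in>(SIGMA v:V. A v). cylinder_length (v @ [a]) powr trott_exponent)"
    by (subst F, subst sum.reindex) (auto simp: inj_on_def case_prod_unfold)
  also have "\<dots> = (\<Sum>v\<in>V. \<Sum>a\<in>A v. cylinder_length (v @ [a]) powr trott_exponent)"
    using finV finA by (simp add: sum.Sigma)
  also have "\<dots> \<le> (\<Sum>v\<in>V. c * cylinder_length v powr trott_exponent)"
    by (intro sum_mono step)
  also have "\<dots> \<le> c * cover_bound n"
    using Suc.IH[OF finV V] by (simp add: c_def flip: sum_distrib_left)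
  finally show ?case by (simp add: c_def)
qed

subsection \<open>Hausdorff measure\<close>

lemma hausdorff_measure_eq_0I:
  assumes "\<And>\<delta> \<epsilon>. 0 < \<delta> \<Longrightarrow> 0 < \<epsilon> \<Longrightarrow> \<exists>U\<in>delta_covers \<delta> A. (\<Sum>i. diam_weight s (U i)) \<le> ennreal \<epsilon>"
  shows "hausdorff_measure s A = 0"
proof -
  have "(INF U\<in>delta_covers \<delta> A. \<Sum>i. diam_weight s (U i)) \<le> 0" if "0 < \<delta>" for \<delta>
  proof (rule ennreal_le_epsilon)
    fix \<epsilon> :: real assume "0 < \<epsilon>"
    with assms[OF that] obtain U where "U \<in> delta_covers \<delta> A" "(\<Sum>i. diam_weight s (U i)) \<le> ennreal \<epsilon>"
      by blast
    then show "(INF U\<in>delta_covers \<delta> A. \<Sum>i. diam_weight s (U i)) \<le> 0 + ennreal \<epsilon>"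
      by (auto intro: INF_lower2)
  qed
  then have "hausdorff_measure s A \<le> 0"
    unfolding hausdorff_measure_def by (intro SUP_least) auto
  then show ?thesis by simp
qed

lemma hausdorff_measure_eq_0D:
  assumes "hausdorff_measure s A = 0" "0 < \<delta>" "0 < \<epsilon>"
  shows "\<exists>U\<in>delta_covers \<delta> A. (\<Sum>i. diam_weight s (U i)) \<le> \<epsilon>"
proof -
  have "(INF U\<in>delta_covers \<delta> A. \<Sum>i. diam_weight s (U i)) \<le> hausdorff_measure s A"
    unfolding hausdorff_measure_def using assms(2) by (intro SUP_upper) auto
  then have "(INF U\<in>delta_covers \<delta> A. \<Sum>i. diam_weight s (U i)) < \<epsilon>"
    using assms by simp
  then show ?thesis by (auto simp: INF_less_iff intro: less_imp_le)
qed

lemma hausdorff_measure_UN_eq_0: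
  fixes A :: "nat \<Rightarrow> 'a::metric_space set"
  assumes "\<And>i. hausdorff_measure s (A i) = 0"
  shows "hausdorff_measure s (\<Union>i. A i) = 0"
proof (rule hausdorff_measure_eq_0I)
  fix \<delta> \<epsilon> :: real assume pos: "0 < \<delta>" "0 < \<epsilon>"
  \<comment> \<open>The allowances for the single sets add up to \<epsilon>; the covers are then
    merged along an enumeration of pairs.\<close>
  have "\<exists>U\<in>delta_covers \<delta> (A i). (\<Sum>j. diam_weight s (U j)) \<le> ennreal (\<epsilon> * (1 / 2) ^ Suc i)" for i
    using pos by (intro hausdorff_measure_eq_0D assms) auto
  then obtain U where U: "\<And>i. U i \<in> delta_covers \<delta> (A i)"
    and sum: "\<And>i. (\<Sum>j. diam_weight s (U i j)) \<le> ennreal (\<epsilon> * (1 / 2) ^ Suc i)"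
    by metis
  define V where "V n = (case prod_decode n of (i, j) \<Rightarrow> U i j)" for n
  have cover: "V \<in> delta_covers \<delta> (\<Union>i. A i)"
    unfolding delta_covers_def
  proof (intro CollectI conjI allI subsetI)
    fix x assume "x \<in> (\<Union>i. A i)"
    then obtain i j where "x \<in> U i j" using U by (fastforce simp: delta_covers_def)
    then show "x \<in> (\<Union>n. V n)" by (auto simp: V_def intro!: exI[of _ "prod_encode (i, j)"])
  qed (use U in \<open>auto simp: V_def delta_covers_def split: prod.split\<close>)
  have "(\<Sum>n. diam_weight s (V n)) = (\<Sum>i. \<Sum>j. diam_weight s (U i j))"
    using suminf_ennreal_2dimen[of "\<lambda>i. \<Sum>j. diam_weight s (U i j)" "\<lambda>(i, j). diam_weight s (U i j)"]
    by (simp add: V_def case_prod_unfold)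
  also have "\<dots> \<le> (\<Sum>i. ennreal (\<epsilon> * (1 / 2) ^ Suc i))"
    using sum by (intro suminf_le summableI)
  also have "\<dots> = ennreal \<epsilon>"
    using sums_mult[OF power_half_series, of \<epsilon>] pos by (intro suminf_ennreal_eq) auto
  finally show "\<exists>U\<in>delta_covers \<delta> (\<Union>i. A i). (\<Sum>i. diam_weight s (U i)) \<le> ennreal \<epsilon>"
    using cover by blast
qed

section \<open>Covers of the Trott numbers by cylinders\<close>

definition cylinder :: "nat list \<Rightarrow> real set" where
  "cylinder w = {min (cfrac_tail w 0) (cfrac_tail w 1)..max (cfrac_tail w 0) (cfrac_tail w 1)}"

lemma diameter_cylinder: "diameter (cylinder w) = cylinder_length w"
  by (auto simp: cylinder_def cylinder_length_def)

lemma diam_weight_cylinder: "0 < s \<Longrightarrow> diam_weight s (cylinder w) = ennreal (cylinder_length w powr s)"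
  by (auto simp: diam_weight_def diameter_cylinder) (auto simp: cylinder_def)

lemma trott_expansion_in_cylinder:
  assumes "trott_expansion b x a"
  shows "x \<in> cylinder (map a [0..<n])" "map a [0..<n] \<in> trott_prefixes b"
proof -
  have cf: "has_cfrac x a" using assms by (simp add: trott_expansion_def)
  obtain y where y: "has_cfrac y (\<lambda>i. a (n + i))" "x = cfrac_tail (map a [0..<n]) y"
    using has_cfrac_tail[OF cf] .
  show "map a [0..<n] \<in> trott_prefixes b" using assms by (auto simp: trott_prefixes_def)
  then have "0 \<notin> set (map a [0..<n])" by (rule trott_prefixes_pos)
  then show "x \<in> cylinder (map a [0..<n])"
    unfolding cylinder_def y(2) using has_cfrac_pos[OF y(1)] has_cfrac_less_1[OF y(1)]
    by (intro cfrac_tail_in_cylinder) auto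
qed

lemma cover_bound_small:
  assumes "0 < \<epsilon>"
  obtains m where "cover_bound (2 * m) < \<epsilon>"
  using real_arch_pow_inv[of \<epsilon> "94 / 100 * (104 / 100)"] assms that by (auto simp: cover_bound_double)

text \<open>The one-word case of the sum bound; it makes the covers fine as well as cheap.\<close>

lemma cylinder_length_le:
  assumes "w \<in> trott_prefixes b" "2 \<le> b"
  shows "cylinder_length w powr trott_exponent \<le> cover_bound (length w)"
  using sum_cylinder_length_le[of "{w}" b "length w"] assms by simp

lemma cylinder_length_le_radius:
  assumes "w \<in> trott_prefixes b" "2 \<le> b" "0 < \<delta>" "cover_bound (length w) \<le> \<delta> powr trott_exponent"
  shows "cylinder_length w \<le> \<delta>"
proof (rule ccontr)
  assume "\<not> cylinder_length w \<le> \<delta>"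
  then have "\<delta> powr trott_exponent < cylinder_length w powr trott_exponent"
    using assms(3) by (intro powr_less_mono2) (auto simp: trott_exponent_def)
  with assms(4) cylinder_length_le[OF assms(1,2)] show False by simp
qed

lemma hausdorff_measure_trott_numbers:
  assumes "2 \<le> b"
  shows "hausdorff_measure trott_exponent (trott_numbers b) = 0"
proof (rule hausdorff_measure_eq_0I)
  fix \<delta> \<epsilon> :: real assume pos: "0 < \<delta>" "0 < \<epsilon>"
  then obtain m where m: "cover_bound (2 * m) < min \<epsilon> (\<delta> powr trott_exponent)"
    using cover_bound_small[of "min \<epsilon> (\<delta> powr trott_exponent)"] by auto
  define P where "P = {w \<in> trott_prefixes b. length w = 2 * m}"
  \<comment> \<open>Enumerates \<open>P\<close>. Requiring \<open>to_nat (from_nat i) = i\<close>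
    keeps a word from being counted twice; all other indices get the empty set, of weight 0.\<close>
  define U where "U i = (if from_nat i \<in> P \<and> to_nat (from_nat i :: nat list) = i
    then cylinder (from_nat i) else {})" for i
  have cover: "U \<in> delta_covers \<delta> (trott_numbers b)"
    unfolding delta_covers_def
  proof (intro CollectI conjI allI subsetI)
    fix x assume "x \<in> trott_numbers b"
    then obtain a where a: "trott_expansion b x a" by (auto simp: trott_numbers_expansion)
    let ?w = "map a [0..<2 * m]"
    have "?w \<in> P" "x \<in> cylinder ?w" using trott_expansion_in_cylinder[OF a] by (auto simp: P_def)
    then have "x \<in> U (to_nat ?w)" by (simp add: U_def)
    then show "x \<in> (\<Union>i. U i)" by blast
  next
    fix i
    show "bounded (U i)" by (auto simp: U_def cylinder_def)
    show "diameter (U i) \<le> \<delta>"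
      using pos m assms cylinder_length_le_radius[of "from_nat i" b \<delta>]
      by (auto simp: U_def P_def diameter_cylinder)
  qed
  have "(\<Sum>i<N. diam_weight trott_exponent (U i)) \<le> ennreal \<epsilon>" for N
  proof -
    define I where "I = {i. i < N \<and> from_nat i \<in> P \<and> to_nat (from_nat i :: nat list) = i}"
    have inj: "inj_on (from_nat :: nat \<Rightarrow> nat list) I"
      by (rule inj_on_inverseI[of _ to_nat]) (auto simp: I_def)
    have "(\<Sum>i<N. diam_weight trott_exponent (U i)) = (\<Sum>i\<in>I. diam_weight trott_exponent (U i))"
      by (rule sum.mono_neutral_right) (auto simp: I_def U_def diam_weight_def)
    also have "\<dots> = (\<Sum>i\<in>I. ennreal (cylinder_length (from_nat i) powr trott_exponent))"
      by (rule sum.cong) (auto simp: I_def U_def diam_weight_cylinder trott_exponent_def)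
    also have "\<dots> = ennreal (\<Sum>w\<in>from_nat ` I. cylinder_length w powr trott_exponent)"
      by (simp add: sum.reindex[OF inj])
    also have "\<dots> \<le> ennreal (cover_bound (2 * m))"
      using assms by (intro ennreal_leI sum_cylinder_length_le) (auto simp: I_def P_def)
    also have "\<dots> \<le> ennreal \<epsilon>" using m by (intro ennreal_leI) simp
    finally show ?thesis .
  qed
  then have "(\<Sum>i. diam_weight trott_exponent (U i)) \<le> ennreal \<epsilon>"
    by (intro suminf_le_const summableI)
  with cover show "\<exists>U\<in>delta_covers \<delta> (trott_numbers b).
      (\<Sum>i. diam_weight trott_exponent (U i)) \<le> ennreal \<epsilon>" by blast
qed

subsection \<open>Nowhere density\<close>

lemma nowhere_dense_iff:
  "nowhere_dense S \<longleftrightarrow> (\<forall>U. open U \<and> U \<noteq> {} \<longrightarrow> (\<exists>V. open V \<and> V \<noteq> {} \<and> V \<subseteq> U \<and> V \<inter> S = {}))"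
proof
  assume S: "nowhere_dense S"
  show "\<forall>U. open U \<and> U \<noteq> {} \<longrightarrow> (\<exists>V. open V \<and> V \<noteq> {} \<and> V \<subseteq> U \<and> V \<inter> S = {})"
  proof (intro allI impI)
    fix U :: "'a set" assume U: "open U \<and> U \<noteq> {}"
    then have "\<not> U \<subseteq> closure S"
      using S interior_maximal unfolding nowhere_dense_def by blast
    with U closure_subset[of S] show "\<exists>V. open V \<and> V \<noteq> {} \<and> V \<subseteq> U \<and> V \<inter> S = {}"
      by (intro exI[of _ "U - closure S"]) auto
  qed
next
  assume *: "\<forall>U. open U \<and> U \<noteq> {} \<longrightarrow> (\<exists>V. open V \<and> V \<noteq> {} \<and> V \<subseteq> U \<and> V \<inter> S = {})"
  show "nowhere_dense S"
    unfolding nowhere_dense_def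
  proof (rule ccontr)
    assume "interior (closure S) \<noteq> {}"
    with * obtain V where V: "open V" "V \<noteq> {}" "V \<subseteq> interior (closure S)" "V \<inter> S = {}"
      by (meson open_interior)
    then have "V \<inter> closure S = {}" by (simp add: open_Int_closure_eq_empty)
    with V interior_subset show False by blast
  qed
qed

lemma nowhere_dense_UN:
  assumes "finite I" "\<And>i. i \<in> I \<Longrightarrow> nowhere_dense (S i)"
  shows "nowhere_dense (\<Union>i\<in>I. S i)"
  using assms
proof (induction I)
  case (insert i I)
  then have "nowhere_dense (S i)" "nowhere_dense (\<Union>i\<in>I. S i)" by auto
  then show ?case
    by (simp add: nowhere_dense_def closure_Un interior_closed_Un_empty_interior)
qed (simp add: nowhere_dense_def)

text \<open>Both \<open>b\<close> and \<open>b + 1\<close> have two digits, so at most one of them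
  can follow a word of even length.\<close>

lemma trott_prefixes_gap:
  assumes "2 \<le> b" "even (length w)"
  obtains c where "0 < c" "w @ [c] \<notin> trott_prefixes b"
proof -
  have div: "(b + 1) div b = 1" "b div b = 1"
    using assms(1) by (auto intro!: div_nat_eqI)
  have "length (base_digits b 1) = 1" using assms(1) by (subst base_digits.simps) simp
  then have "length (base_digits b b) = 2" "length (base_digits b (b + 1)) = 2"
    using assms(1) by (subst base_digits.simps, simp add: div del: One_nat_def)+
  then have "\<not> (w @ [b] \<in> trott_prefixes b \<and> w @ [b + 1] \<in> trott_prefixes b)"
    using trott_prefixes_even_unique[of w b b "b + 1"] assms by auto
  with that[of b] that[of "b + 1"] assms(1) show thesis by auto
qed

lemma nowhere_dense_trott_numbers:
  assumes "2 \<le> b"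
  shows "nowhere_dense (trott_numbers b)"
  unfolding nowhere_dense_iff
proof (intro allI impI)
  fix U :: "real set" assume U: "open U \<and> U \<noteq> {}"
  show "\<exists>V. open V \<and> V \<noteq> {} \<and> V \<subseteq> U \<and> V \<inter> trott_numbers b = {}"
  proof (cases "U \<inter> trott_numbers b = {}")
    case False
    then obtain x where x: "x \<in> U" "x \<in> trott_numbers b" by auto
    then obtain a where a: "trott_expansion b x a" by (auto simp: trott_numbers_expansion)
    obtain e where e: "0 < e" "ball x e \<subseteq> U" using U x open_contains_ball by blast
    \<comment> \<open>Halving \<open>e\<close> turns the weak bound on the cylinder length into a
      strict one.\<close>
    obtain m where m: "cover_bound (2 * m) < (e / 2) powr trott_exponent"
      using cover_bound_small[of "(e / 2) powr trott_exponent"] e by auto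
    define w where "w = map a [0..<2 * m]"
    have wP: "w \<in> trott_prefixes b" and xw: "x \<in> cylinder w"
      using trott_expansion_in_cylinder[OF a] by (auto simp: w_def)
    have w0: "0 \<notin> set w" using wP by (rule trott_prefixes_pos)
    have ev: "even (length w)" by (simp add: w_def)
    have len: "cylinder_length w < e"
      using cylinder_length_le_radius[of w b "e / 2"] e m wP assms by (simp add: w_def)
    have sub: "cylinder w \<subseteq> U"
    proof
      fix t assume "t \<in> cylinder w"
      with xw have "dist x t \<le> cylinder_length w"
        by (auto simp: cylinder_def cylinder_length_def dist_real_def)
      with len e(2) show "t \<in> U" by auto
    qed
    obtain c where c: "0 < c" "w @ [c] \<notin> trott_prefixes b"
      using trott_prefixes_gap[OF assms ev] .
    \<comment> \<open>The missing child corresponds to the tails between \<open>u\<close> and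
      \<open>v\<close>; as \<open>w\<close> has even length, its interior is \<open>V\<close>, with
      the endpoints in this order.\<close>
    define u v where "u = 1 / (real c + 1)" and "v = 1 / real c"
    have uv: "0 < u" "u < v" "v \<le> 1" using c(1) by (auto simp: u_def v_def field_simps)
    define V where "V = {cfrac_tail w u<..<cfrac_tail w v}"
    have "V \<noteq> {}" using cfrac_tail_strict_mono[OF w0, of u v] uv ev by (simp add: V_def)
    moreover have "V \<subseteq> U"
    proof -
      have "cfrac_tail w u \<in> cylinder w" "cfrac_tail w v \<in> cylinder w"
        unfolding cylinder_def using uv
        by (auto intro!: cfrac_tail_in_cylinder w0 simp del: atLeastAtMost_iff)
      then have "V \<subseteq> cylinder w" by (auto simp: V_def cylinder_def)
      with sub show ?thesis by blast
    qed
    moreover have False if x': "x' \<in> V" "trott_expansion b x' a'" for x' a'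
    proof -
      \<comment> \<open>By the intermediate value theorem, every point of \<open>V\<close> has a
        tail \<open>y\<close> strictly between \<open>u\<close> and \<open>v\<close>, hence
        \<open>c\<close> as its next quotient.\<close>
      have "continuous_on {u..v} (cfrac_tail w)"
        using continuous_on_subset[OF continuous_on_cfrac_tail[OF w0]] uv by simp
      then obtain y where y: "u \<le> y" "y \<le> v" "cfrac_tail w y = x'"
        using IVT'[of "cfrac_tail w" u x' v] x'(1) uv by (auto simp: V_def)
      moreover have "u \<noteq> y" "y \<noteq> v" using x'(1) y(3) by (auto simp: V_def)
      ultimately have "u < y" "y < v" by auto
      define z where "z = 1 / y - real c"
      have "0 < y" using \<open>u < y\<close> uv by simp
      have "real c < 1 / y" using \<open>y < v\<close> \<open>0 < y\<close> c(1) by (simp add: v_def field_simps)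
      moreover have "1 / y < real c + 1" using \<open>u < y\<close> \<open>0 < y\<close> by (simp add: u_def field_simps)
      ultimately have "0 < z" "z < 1" "y = 1 / (real c + z)" by (auto simp: z_def)
      then have "x' = cfrac_tail (w @ [c]) z" using y(3) by (simp add: cfrac_tail_append)
      then have "map a' [0..<length (w @ [c])] = w @ [c]"
        using has_cfrac_prefix_unique[of "w @ [c]" z a'] x'(2) w0 c(1) \<open>0 < z\<close> \<open>z < 1\<close>
        by (auto simp: trott_expansion_def)
      with x'(2) c(2) show False unfolding trott_prefixes_def by blast
    qed
    then have "V \<inter> trott_numbers b = {}" by (auto simp: trott_numbers_expansion)
    moreover have "open V" by (simp add: V_def)
    ultimately show ?thesis by blast
  qed (use U in blast)
qed

text \<open>A lower bound on \<open>x\<close> bounds the first quotient \<open>a 0\<close> above,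
  while its digits, at least one, give \<open>b <= (a 0 + 1) / x\<close>.\<close>

lemma trott_numbers_base_bound:
  assumes "x \<in> trott_numbers b" "2 \<le> b" "0 < \<epsilon>" "\<epsilon> < x"
  shows "real b \<le> (1 / \<epsilon> + 1) / \<epsilon>"
proof -
  obtain a where a: "trott_expansion b x a" using assms(1) by (auto simp: trott_numbers_expansion)
  let ?k = "length (base_digits b (a 0))"
  obtain y z where y: "0 < y" and z: "z \<le> 1"
    and x: "x = 1 / (real (a 0) + y)" "x = (real (a 0) + z) / real b ^ ?k"
    using trott_expansion_split[OF a assms(2), of 0] unfolding upt_0 by simp metis
  have "real (a 0) < 1 / x" using x(1) y by simp
  also have "\<dots> \<le> 1 / \<epsilon>" using assms(3,4) by (intro divide_left_mono) auto
  finally have a0: "real (a 0) + z \<le> 1 / \<epsilon> + 1" using z by simp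
  have "real b ^ 1 \<le> real b ^ ?k"
    using assms(2) base_digits_nonempty[of b "a 0"] by (intro power_increasing) (auto simp: Suc_le_eq)
  also have "\<dots> = (real (a 0) + z) / x"
  proof -
    have "x * real b ^ ?k = real (a 0) + z" using x(2) assms(2) by simp
    then show ?thesis using assms(3,4) by (simp add: field_simps)
  qed
  also have "\<dots> \<le> (1 / \<epsilon> + 1) / x" using a0 assms(3,4) by (intro divide_right_mono) auto
  also have "\<dots> \<le> (1 / \<epsilon> + 1) / \<epsilon>" using assms(3,4) by (intro divide_left_mono) auto
  finally show ?thesis by simp
qed

lemma nowhere_dense_Union_trott_numbers: "nowhere_dense (\<Union>b\<in>{2..}. trott_numbers b)"
  unfolding nowhere_dense_iff
proof (intro allI impI)
  let ?T = "\<Union>b\<in>{2..}. trott_numbers b"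
  fix U :: "real set" assume U: "open U \<and> U \<noteq> {}"
  show "\<exists>V. open V \<and> V \<noteq> {} \<and> V \<subseteq> U \<and> V \<inter> ?T = {}"
  proof (cases "U \<inter> ?T = {}")
    case False
    then obtain x where x: "x \<in> U" "0 < x" by (auto simp: trott_numbers_def)
    \<comment> \<open>Beyond \<open>x / 2\<close> only the bases up to \<open>B\<close> contribute,
      so a finite union remains.\<close>
    define \<epsilon> where "\<epsilon> = x / 2"
    have \<epsilon>: "0 < \<epsilon>" "\<epsilon> < x" using x by (auto simp: \<epsilon>_def)
    define B where "B = nat \<lceil>(1 / \<epsilon> + 1) / \<epsilon>\<rceil>"
    have nd: "nowhere_dense (\<Union>b\<in>{2..B}. trott_numbers b)"
      by (intro nowhere_dense_UN nowhere_dense_trott_numbers) auto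
    have "open (U \<inter> {\<epsilon><..}) \<and> U \<inter> {\<epsilon><..} \<noteq> {}" using U x \<epsilon> by auto
    from nd[unfolded nowhere_dense_iff, rule_format, OF this]
    obtain V where V: "open V" "V \<noteq> {}" "V \<subseteq> U \<inter> {\<epsilon><..}"
      "V \<inter> (\<Union>b\<in>{2..B}. trott_numbers b) = {}"
      by blast
    have "b \<le> B" if "t \<in> V" "t \<in> trott_numbers b" "2 \<le> b" for t b
    proof -
      have "real b \<le> (1 / \<epsilon> + 1) / \<epsilon>"
        using trott_numbers_base_bound[OF that(2,3) \<epsilon>(1)] that(1) V(3) by auto
      then show ?thesis unfolding B_def by linarith
    qed
    then have "t \<in> (\<Union>b\<in>{2..B}. trott_numbers b)" if "t \<in> V" "t \<in> trott_numbers b" "2 \<le> b" for t b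
      using that by (intro UN_I[of b]) simp_all
    with V(4) have "V \<inter> ?T = {}" by blast
    moreover have "V \<subseteq> U" using V(3) by simp
    ultimately show ?thesis using V(1,2) by blast
  qed (use U in blast)
qed

theorem theorem1p4:
  fixes T :: "real set"
  defines "T \<equiv> \<Union>b\<in>{2..}. trott_numbers b"
  shows "nowhere_dense T \<and> hausdorff_dim T < 1"
proof
  show "nowhere_dense T" unfolding T_def by (rule nowhere_dense_Union_trott_numbers)
  \<comment> \<open>Reindexed over all naturals for countable stability; the exponent is the same
    for every base.\<close>
  have "T = (\<Union>i. trott_numbers (2 + i))"
  proof -
    have "{2..} = range ((+) (2::nat))" by (auto simp: image_iff le_iff_add)
    then show ?thesis by (simp add: T_def)
  qed
  then have "hausdorff_measure trott_exponent T = 0"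
    by (simp add: hausdorff_measure_UN_eq_0 hausdorff_measure_trott_numbers)
  then have "hausdorff_dim T \<le> ennreal trott_exponent"
    unfolding hausdorff_dim_def by (intro INF_lower) (auto simp: trott_exponent_def)
  also have "\<dots> < 1" by (simp add: trott_exponent_def ennreal_less_one_iff)
  finally show "hausdorff_dim T < 1" .
qed

end
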